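(* Let $\mathbb T=(\mathbf A,\mathbf B,\mathbf T,\widehat{\mathbf T},\mathrm{ev},\widehat{\mathrm{ev}})$ be a Morita context on categories $\mathcal X$ and $\mathcal Y$. Then $((\mathcal X,\mathcal Y)^{\mathbb T},(G_A,U_A),(G_B,U_B))$ is a double adjunction on $\mathcal X$ and $\mathcal Y$, i.e. $(G_A,U_A)$ and $(G_B,U_B)$ are adjoint pairs with $G_A$, $G_B$ the left adjoints.
   Context: Composition of functors is juxtaposition; identities are denoted by the object/functor itself. For monads $\mathbf A=(A,\mathsf m^A,\mathsf u^A)$ on $\mathcal X$ and $\mathbf B=(B,\mathsf m^B,\mathsf u^B)$ on $\mathcal Y$, an $\mathbf A$-$\mathbf B$ bialgebra functor $\mathbf T=(T,\lambda,\rho)$ is a functor $T:\mathcal Y\to\mathcal X$ with natural transformations $\lambda:AT\to T$, $\rho:TB\to T$ such that $\rho\circ T\mathsf m^B=\rho\circ\rho B$, $\rho\circ T\mathsf u^B=T$, $\lambda\circ\mathsf m^AT=\lambda\circ A\lambda$, $\lambda\circ\mathsf u^AT=T$, $\rho\circ\lambda B=\lambda\circ A\rho$. A Morita context $\mathbb T=(\mathbf A,\mathbf B,\mathbf T,\widehat{\mathbf T},\mathrm{ev},\widehat{\mathrm{ev}})$ on $\mathcal X,\mathcal Y$ consists of monads $\mathbf A$ on $\mathcal X$, $\mathbf B$ on $\mathcal Y$, an $\mathbf A$-$\mathbf B$ bialgebra functor $\mathbf T=(T,\lambda,\rho)$, a $\mathbf B$-$\mathbf A$ bialgebra functor $\widehat{\mathbf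 T}=(\widehat T:\mathcal X\to\mathcal Y,\ \hat\lambda:B\widehat T\to\widehat T,\ \hat\rho:\widehat TA\to\widehat T)$, and natural transformations $\mathrm{ev}:T\widehat T\to A$, $\widehat{\mathrm{ev}}:\widehat TT\to B$ with $\mathrm{ev}\circ\lambda\widehat T=\mathsf m^A\circ A\,\mathrm{ev}$, $\mathrm{ev}\circ T\hat\rho=\mathsf m^A\circ\mathrm{ev}A$, $\widehat{\mathrm{ev}}\circ\hat\lambda T=\mathsf m^B\circ B\,\widehat{\mathrm{ev}}$, $\widehat{\mathrm{ev}}\circ\widehat T\rho=\mathsf m^B\circ\widehat{\mathrm{ev}}B$, $\rho\circ T\widehat{\mathrm{ev}}=\lambda\circ\mathrm{ev}T$, $\hat\lambda\circ\widehat{\mathrm{ev}}\widehat T=\hat\rho\circ\widehat T\mathrm{ev}$, $\widehat{\mathrm{ev}}\circ\widehat T\lambda=\widehat{\mathrm{ev}}\circ\hat\rho T$, $\mathrm{ev}\circ\rho\widehat T=\mathrm{ev}\circ T\hat\lambda$. The Eilenberg-Moore category $(\mathcal X,\mathcal Y)^{\mathbb T}$ has objects $\mathbf X=((X,\rho^X),(Y,\rho^Y),v,w)$ with $(X,\rho^X)$ an $\mathbf A$-algebra, $(Y,\rho^Y)$ a $\mathbf B$-algebra, $v:TY\to X$, $w:\widehat TX\to Y$ with $v\circ\lambda Y=\rho^X\circ Av$, $w\circ\hat\lambda X=\rho^Y\circ Bw$, $v\circ Tw=\rho^X\circ\mathrm{ev}X$, $w\circ\widehat Tv=\rho^Y\circ\widehat{\mathrm{ev}}Y$,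 $w\circ\widehat T\rho^X=w\circ\hat\rho X$, $v\circ T\rho^Y=v\circ\rho Y$. Morphisms: pairs $(f,g)$ of an $\mathbf A$-algebra morphism $f:X\to X'$ and a $\mathbf B$-algebra morphism $g:Y\to Y'$ with $g\circ w=w'\circ\widehat Tf$, $f\circ v=v'\circ Tg$. $U_A:(\mathcal X,\mathcal Y)^{\mathbb T}\to\mathcal X$ and $U_B:(\mathcal X,\mathcal Y)^{\mathbb T}\to\mathcal Y$ are the forgetful functors ($U_A\mathbf X=X$, $U_B\mathbf X=Y$), and $G_A:\mathcal X\to(\mathcal X,\mathcal Y)^{\mathbb T}$, $G_B:\mathcal Y\to(\mathcal X,\mathcal Y)^{\mathbb T}$ are $G_AX=((AX,\mathsf m^AX),(\widehat TX,\hat\lambda X),\mathrm{ev}X,\hat\rho X)$, $G_Af=(Af,\widehat Tf)$; $G_BY=((TY,\lambda Y),(BY,\mathsf m^BY),\rho Y,\widehat{\mathrm{ev}}Y)$, $G_Bg=(Tg,Bg)$. A double adjunction on $\mathcal X,\mathcal Y$ is a category $\mathcal Z$ with adjunctions $(L_A:\mathcal X\to\mathcal Z,R_A:\mathcal Z\to\mathcal X)$ and $(L_B:\mathcal Y\to\mathcal Z,R_B:\mathcal Z\to\mathcal Y)$ (left adjoint listed first). *)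

theory Defs
  imports Main
begin

text \<open>
  A category has a set of objects and a set of arrows inside arbitrary types; every arrow
  determines its domain and codomain.  The operations are total functions whose values are
  meaningful only on objects, arrows and composable pairs.  The term \<open>g \<cdot>\<^bsub>C\<^esub> f\<close> is ``g after f''.
\<close>

record ('o, 'm) cat =
  Obj :: "'o set"
  Arr :: "'m set"
  Dom :: "'m \<Rightarrow> 'o"
  Cod :: "'m \<Rightarrow> 'o"
  Ide :: "'o \<Rightarrow> 'm"
  Comp :: "'m \<Rightarrow> 'm \<Rightarrow> 'm" (infixl "\<cdot>\<index>" 70)

definition hom :: "('o, 'm) cat \<Rightarrow> 'o \<Rightarrow> 'o \<Rightarrow> 'm set" where
  "hom C a b = {f \<in> Arr C. Dom C f = a \<and> Cod C f = b}"

locale category =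
  fixes C :: "('o, 'm) cat" (structure)
  assumes Dom_Obj: "f \<in> Arr C \<Longrightarrow> Dom C f \<in> Obj C"
    and Cod_Obj: "f \<in> Arr C \<Longrightarrow> Cod C f \<in> Obj C"
    and Id_hom: "a \<in> Obj C \<Longrightarrow> Ide C a \<in> hom C a a"
    and Comp_hom: "\<lbrakk>f \<in> hom C a b; g \<in> hom C b c\<rbrakk> \<Longrightarrow> g \<cdot> f \<in> hom C a c"
    and Comp_Id_left: "f \<in> hom C a b \<Longrightarrow> Ide C b \<cdot> f = f"
    and Comp_Id_right: "f \<in> hom C a b \<Longrightarrow> f \<cdot> Ide C a = f"
    and Comp_assoc:
      "\<lbrakk>f \<in> hom C a b; g \<in> hom C b c; h \<in> hom C c d\<rbrakk> \<Longrightarrow> (h \<cdot> g) \<cdot> f = h \<cdot> (g \<cdot> f)"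

record ('o, 'm, 'p, 'n) func =
  fobj :: "'o \<Rightarrow> 'p"
  farr :: "'m \<Rightarrow> 'n"

definition id_func :: "('o, 'm, 'o, 'm) func" where
  "id_func = \<lparr>fobj = (\<lambda>a. a), farr = (\<lambda>f. f)\<rparr>"

definition comp_func ::
  "('p, 'n, 'q, 'k) func \<Rightarrow> ('o, 'm, 'p, 'n) func \<Rightarrow> ('o, 'm, 'q, 'k) func" where
  "comp_func G F = \<lparr>fobj = (\<lambda>a. fobj G (fobj F a)), farr = (\<lambda>f. farr G (farr F f))\<rparr>"

locale is_functor =
  C: category C + D: category D
  for C :: "('o, 'm) cat" and D :: "('p, 'n) cat" +
  fixes F :: "('o, 'm, 'p, 'n) func"
  assumes fobj_Obj: "a \<in> Obj C \<Longrightarrow> fobj F a \<in> Obj D"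
    and farr_hom: "f \<in> hom C a b \<Longrightarrow> farr F f \<in> hom D (fobj F a) (fobj F b)"
    and farr_Id: "a \<in> Obj C \<Longrightarrow> farr F (Ide C a) = Ide D (fobj F a)"
    and farr_Comp:
      "\<lbrakk>f \<in> hom C a b; g \<in> hom C b c\<rbrakk> \<Longrightarrow> farr F (g \<cdot>\<^bsub>C\<^esub> f) = farr F g \<cdot>\<^bsub>D\<^esub> farr F f"

locale nat_trans =
  F: is_functor C D F + G: is_functor C D G
  for C :: "('o, 'm) cat" and D :: "('p, 'n) cat"
    and F :: "('o, 'm, 'p, 'n) func" and G :: "('o, 'm, 'p, 'n) func" +
  fixes \<tau> :: "'o \<Rightarrow> 'n"
  assumes component_hom: "a \<in> Obj C \<Longrightarrow> \<tau> a \<in> hom D (fobj F a) (fobj G a)"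
    and naturality: "f \<in> hom C a b \<Longrightarrow> \<tau> b \<cdot>\<^bsub>D\<^esub> farr F f = farr G f \<cdot>\<^bsub>D\<^esub> \<tau> a"

text \<open>
  Equations between natural transformations are stated componentwise at every object.
  For a transformation \<open>\<tau>\<close> and functors \<open>H\<close>, \<open>K\<close>, the component at \<open>a\<close> of \<open>H\<tau>\<close> is
  \<open>farr H (\<tau> a)\<close>, and that of \<open>\<tau>K\<close> is \<open>\<tau> (fobj K a)\<close>.
\<close>

locale adjunction =
  L: is_functor C D L +
  R: is_functor D C R +
  unit: nat_trans C C id_func "comp_func R L" \<eta> +
  counit: nat_trans D D "comp_func L R" id_func \<epsilon>
  for C :: "('o, 'm) cat" and D :: "('p, 'n) cat"
    and L :: "('o, 'm, 'p, 'n) func" and R :: "('p, 'n, 'o, 'm) func" and \<eta> \<epsilon> +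
  assumes triangle_L:
      "a \<in> Obj C \<Longrightarrow> \<epsilon> (fobj L a) \<cdot>\<^bsub>D\<^esub> farr L (\<eta> a) = Ide D (fobj L a)"
    and triangle_R:
      "d \<in> Obj D \<Longrightarrow> farr R (\<epsilon> d) \<cdot>\<^bsub>C\<^esub> \<eta> (fobj R d) = Ide C (fobj R d)"

text \<open>The left adjoint is listed first.\<close>

definition adjoint_pair ::
  "('o, 'm) cat \<Rightarrow> ('p, 'n) cat \<Rightarrow> ('o, 'm, 'p, 'n) func \<Rightarrow> ('p, 'n, 'o, 'm) func \<Rightarrow> bool" where
  "adjoint_pair C D L R \<longleftrightarrow> (\<exists>\<eta> \<epsilon>. adjunction C D L R \<eta> \<epsilon>)"

definition double_adjunction ::
  "('ox, 'mx) cat \<Rightarrow> ('oy, 'my) cat \<Rightarrow> ('oz, 'mz) cat \<Rightarrow>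
   ('ox, 'mx, 'oz, 'mz) func \<times> ('oz, 'mz, 'ox, 'mx) func \<Rightarrow>
   ('oy, 'my, 'oz, 'mz) func \<times> ('oz, 'mz, 'oy, 'my) func \<Rightarrow> bool" where
  "double_adjunction X Y Z = (\<lambda>(L\<^sub>A, R\<^sub>A) (L\<^sub>B, R\<^sub>B).
     category X \<and> category Y \<and> category Z \<and>
     adjoint_pair X Z L\<^sub>A R\<^sub>A \<and> adjoint_pair Y Z L\<^sub>B R\<^sub>B)"

record ('o, 'm) monad_data =
  mfun :: "('o, 'm, 'o, 'm) func"
  mult :: "'o \<Rightarrow> 'm"
  unit :: "'o \<Rightarrow> 'm"

locale monad =
  mfun: is_functor C C "mfun A" +
  mult: nat_trans C C "comp_func (mfun A) (mfun A)" "mfun A" "mult A" +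
  unit: nat_trans C C id_func "mfun A" "unit A"
  for C :: "('o, 'm) cat" and A :: "('o, 'm) monad_data" +
  assumes mult_assoc: "a \<in> Obj C \<Longrightarrow>
      mult A a \<cdot>\<^bsub>C\<^esub> farr (mfun A) (mult A a) = mult A a \<cdot>\<^bsub>C\<^esub> mult A (fobj (mfun A) a)"
    and mult_unit_left: "a \<in> Obj C \<Longrightarrow>
      mult A a \<cdot>\<^bsub>C\<^esub> unit A (fobj (mfun A) a) = Ide C (fobj (mfun A) a)"
    and mult_unit_right: "a \<in> Obj C \<Longrightarrow>
      mult A a \<cdot>\<^bsub>C\<^esub> farr (mfun A) (unit A a) = Ide C (fobj (mfun A) a)"

definition algebra :: "('o, 'm) cat \<Rightarrow> ('o, 'm) monad_data \<Rightarrow> 'o \<times> 'm \<Rightarrow> bool" where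
  "algebra C A = (\<lambda>(x, r).
     x \<in> Obj C \<and> r \<in> hom C (fobj (mfun A) x) x \<and>
     r \<cdot>\<^bsub>C\<^esub> farr (mfun A) r = r \<cdot>\<^bsub>C\<^esub> mult A x \<and>
     r \<cdot>\<^bsub>C\<^esub> unit A x = Ide C x)"

definition algebra_morphism ::
  "('o, 'm) cat \<Rightarrow> ('o, 'm) monad_data \<Rightarrow> 'o \<times> 'm \<Rightarrow> 'o \<times> 'm \<Rightarrow> 'm \<Rightarrow> bool" where
  "algebra_morphism C A = (\<lambda>(x, r) (x', r') f.
     f \<in> hom C x x' \<and> f \<cdot>\<^bsub>C\<^esub> r = r' \<cdot>\<^bsub>C\<^esub> farr (mfun A) f)"

record ('ox, 'mx, 'oy, 'my) bialg_data =
  bfun :: "('oy, 'my, 'ox, 'mx) func"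
  lact :: "'oy \<Rightarrow> 'mx"
  ract :: "'oy \<Rightarrow> 'mx"

text \<open>An \<open>A\<close>-\<open>B\<close> bialgebra functor, where \<open>A\<close> lives on \<open>X\<close>, \<open>B\<close> on \<open>Y\<close> and \<open>bfun T : Y \<rightarrow> X\<close>.\<close>

locale bialgebra_functor =
  A: monad X A +
  B: monad Y B +
  bfun: is_functor Y X "bfun T" +
  lact: nat_trans Y X "comp_func (mfun A) (bfun T)" "bfun T" "lact T" +
  ract: nat_trans Y X "comp_func (bfun T) (mfun B)" "bfun T" "ract T"
  for X :: "('ox, 'mx) cat" and Y :: "('oy, 'my) cat"
    and A :: "('ox, 'mx) monad_data" and B :: "('oy, 'my) monad_data"
    and T :: "('ox, 'mx, 'oy, 'my) bialg_data" +
  assumes ract_mult: "y \<in> Obj Y \<Longrightarrow>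
      ract T y \<cdot>\<^bsub>X\<^esub> farr (bfun T) (mult B y) = ract T y \<cdot>\<^bsub>X\<^esub> ract T (fobj (mfun B) y)"
    and ract_unit: "y \<in> Obj Y \<Longrightarrow>
      ract T y \<cdot>\<^bsub>X\<^esub> farr (bfun T) (unit B y) = Ide X (fobj (bfun T) y)"
    and lact_mult: "y \<in> Obj Y \<Longrightarrow>
      lact T y \<cdot>\<^bsub>X\<^esub> mult A (fobj (bfun T) y) = lact T y \<cdot>\<^bsub>X\<^esub> farr (mfun A) (lact T y)"
    and lact_unit: "y \<in> Obj Y \<Longrightarrow>
      lact T y \<cdot>\<^bsub>X\<^esub> unit A (fobj (bfun T) y) = Ide X (fobj (bfun T) y)"
    and lact_ract: "y \<in> Obj Y \<Longrightarrow>
      ract T y \<cdot>\<^bsub>X\<^esub> lact T (fobj (mfun B) y) = lact T y \<cdot>\<^bsub>X\<^esub> farr (mfun A) (ract T y)"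

text \<open>
  In \<open>morita_data\<close> the fields \<open>mT\<close>, \<open>mT'\<close>, \<open>ev\<close>, \<open>ev'\<close> are the two bialgebra functors
  (unhatted and hatted) and the two evaluation maps (unhatted and hatted).
\<close>

record ('ox, 'mx, 'oy, 'my) morita_data =
  mA :: "('ox, 'mx) monad_data"
  mB :: "('oy, 'my) monad_data"
  mT :: "('ox, 'mx, 'oy, 'my) bialg_data"
  mT' :: "('oy, 'my, 'ox, 'mx) bialg_data"
  ev :: "'ox \<Rightarrow> 'mx"
  ev' :: "'oy \<Rightarrow> 'my"

abbreviation "funA M \<equiv> mfun (mA M)"
abbreviation "funB M \<equiv> mfun (mB M)"
abbreviation "funT M \<equiv> bfun (mT M)"
abbreviation "funT' M \<equiv> bfun (mT' M)"

locale morita_context =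
  A: monad X "mA M" +
  B: monad Y "mB M" +
  T: bialgebra_functor X Y "mA M" "mB M" "mT M" +
  T': bialgebra_functor Y X "mB M" "mA M" "mT' M" +
  ev: nat_trans X X "comp_func (funT M) (funT' M)" "funA M" "ev M" +
  ev': nat_trans Y Y "comp_func (funT' M) (funT M)" "funB M" "ev' M"
  for X :: "('ox, 'mx) cat" and Y :: "('oy, 'my) cat"
    and M :: "('ox, 'mx, 'oy, 'my) morita_data" +
  assumes ev_lact: "x \<in> Obj X \<Longrightarrow>
      ev M x \<cdot>\<^bsub>X\<^esub> lact (mT M) (fobj (funT' M) x) = mult (mA M) x \<cdot>\<^bsub>X\<^esub> farr (funA M) (ev M x)"
    and ev_ract: "x \<in> Obj X \<Longrightarrow>
      ev M x \<cdot>\<^bsub>X\<^esub> farr (funT M) (ract (mT' M) x) = mult (mA M) x \<cdot>\<^bsub>X\<^esub> ev M (fobj (funA M) x)"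
    and ev'_lact: "y \<in> Obj Y \<Longrightarrow>
      ev' M y \<cdot>\<^bsub>Y\<^esub> lact (mT' M) (fobj (funT M) y) = mult (mB M) y \<cdot>\<^bsub>Y\<^esub> farr (funB M) (ev' M y)"
    and ev'_ract: "y \<in> Obj Y \<Longrightarrow>
      ev' M y \<cdot>\<^bsub>Y\<^esub> farr (funT' M) (ract (mT M) y) = mult (mB M) y \<cdot>\<^bsub>Y\<^esub> ev' M (fobj (funB M) y)"
    and ract_ev': "y \<in> Obj Y \<Longrightarrow>
      ract (mT M) y \<cdot>\<^bsub>X\<^esub> farr (funT M) (ev' M y) = lact (mT M) y \<cdot>\<^bsub>X\<^esub> ev M (fobj (funT M) y)"
    and lact_ev': "x \<in> Obj X \<Longrightarrow>
      lact (mT' M) x \<cdot>\<^bsub>Y\<^esub> ev' M (fobj (funT' M) x) = ract (mT' M) x \<cdot>\<^bsub>Y\<^esub> farr (funT' M) (ev M x)"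
    and ev'_balanced: "y \<in> Obj Y \<Longrightarrow>
      ev' M y \<cdot>\<^bsub>Y\<^esub> farr (funT' M) (lact (mT M) y) = ev' M y \<cdot>\<^bsub>Y\<^esub> ract (mT' M) (fobj (funT M) y)"
    and ev_balanced: "x \<in> Obj X \<Longrightarrow>
      ev M x \<cdot>\<^bsub>X\<^esub> ract (mT M) (fobj (funT' M) x) = ev M x \<cdot>\<^bsub>X\<^esub> farr (funT M) (lact (mT' M) x)"

type_synonym ('ox, 'mx, 'oy, 'my) em_obj = "('ox \<times> 'mx) \<times> ('oy \<times> 'my) \<times> 'mx \<times> 'my"

text \<open>
  A pair \<open>(f, g)\<close> can be a morphism between several pairs of objects, so an arrow also records
  its domain and codomain.
\<close>

type_synonym ('ox, 'mx, 'oy, 'my) em_arr =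
  "('ox, 'mx, 'oy, 'my) em_obj \<times> ('mx \<times> 'my) \<times> ('ox, 'mx, 'oy, 'my) em_obj"

definition em_object ::
  "('ox, 'mx) cat \<Rightarrow> ('oy, 'my) cat \<Rightarrow> ('ox, 'mx, 'oy, 'my) morita_data \<Rightarrow>
   ('ox, 'mx, 'oy, 'my) em_obj \<Rightarrow> bool" where
  "em_object X Y M = (\<lambda>((x, r), (y, s), v, w).
     algebra X (mA M) (x, r) \<and> algebra Y (mB M) (y, s) \<and>
     v \<in> hom X (fobj (funT M) y) x \<and> w \<in> hom Y (fobj (funT' M) x) y \<and>
     v \<cdot>\<^bsub>X\<^esub> lact (mT M) y = r \<cdot>\<^bsub>X\<^esub> farr (funA M) v \<and>
     w \<cdot>\<^bsub>Y\<^esub> lact (mT' M) x = s \<cdot>\<^bsub>Y\<^esub> farr (funB M) w \<and>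
     v \<cdot>\<^bsub>X\<^esub> farr (funT M) w = r \<cdot>\<^bsub>X\<^esub> ev M x \<and>
     w \<cdot>\<^bsub>Y\<^esub> farr (funT' M) v = s \<cdot>\<^bsub>Y\<^esub> ev' M y \<and>
     w \<cdot>\<^bsub>Y\<^esub> farr (funT' M) r = w \<cdot>\<^bsub>Y\<^esub> ract (mT' M) x \<and>
     v \<cdot>\<^bsub>X\<^esub> farr (funT M) s = v \<cdot>\<^bsub>X\<^esub> ract (mT M) y)"

definition em_morphism ::
  "('ox, 'mx) cat \<Rightarrow> ('oy, 'my) cat \<Rightarrow> ('ox, 'mx, 'oy, 'my) morita_data \<Rightarrow>
   ('ox, 'mx, 'oy, 'my) em_obj \<Rightarrow> ('ox, 'mx, 'oy, 'my) em_obj \<Rightarrow> 'mx \<times> 'my \<Rightarrow> bool" where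
  "em_morphism X Y M = (\<lambda>(a, b, v, w) (a', b', v', w') (f, g).
     algebra_morphism X (mA M) a a' f \<and> algebra_morphism Y (mB M) b b' g \<and>
     g \<cdot>\<^bsub>Y\<^esub> w = w' \<cdot>\<^bsub>Y\<^esub> farr (funT' M) f \<and>
     f \<cdot>\<^bsub>X\<^esub> v = v' \<cdot>\<^bsub>X\<^esub> farr (funT M) g)"

definition EM_cat ::
  "('ox, 'mx) cat \<Rightarrow> ('oy, 'my) cat \<Rightarrow> ('ox, 'mx, 'oy, 'my) morita_data \<Rightarrow>
   (('ox, 'mx, 'oy, 'my) em_obj, ('ox, 'mx, 'oy, 'my) em_arr) cat" where
  "EM_cat X Y M = \<lparr>
     Obj = {P. em_object X Y M P},
     Arr = {(P, h, Q). em_object X Y M P \<and> em_object X Y M Q \<and> em_morphism X Y M P Q h},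
     Dom = (\<lambda>(P, h, Q). P),
     Cod = (\<lambda>(P, h, Q). Q),
     Ide = (\<lambda>P. case P of ((x, r), (y, s), v, w) \<Rightarrow> (P, (Ide X x, Ide Y y), P)),
     Comp = (\<lambda>(Q, (f', g'), R) (P, (f, g), Q'). (P, (f' \<cdot>\<^bsub>X\<^esub> f, g' \<cdot>\<^bsub>Y\<^esub> g), R))\<rparr>"

definition U_A :: "(('ox, 'mx, 'oy, 'my) em_obj, ('ox, 'mx, 'oy, 'my) em_arr, 'ox, 'mx) func" where
  "U_A = \<lparr>fobj = (\<lambda>((x, r), (y, s), v, w). x), farr = (\<lambda>(P, (f, g), Q). f)\<rparr>"

definition U_B :: "(('ox, 'mx, 'oy, 'my) em_obj, ('ox, 'mx, 'oy, 'my) em_arr, 'oy, 'my) func" where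
  "U_B = \<lparr>fobj = (\<lambda>((x, r), (y, s), v, w). y), farr = (\<lambda>(P, (f, g), Q). g)\<rparr>"

definition GA_obj ::
  "('ox, 'mx, 'oy, 'my) morita_data \<Rightarrow> 'ox \<Rightarrow> ('ox, 'mx, 'oy, 'my) em_obj" where
  "GA_obj M x = ((fobj (funA M) x, mult (mA M) x), (fobj (funT' M) x, lact (mT' M) x),
     ev M x, ract (mT' M) x)"

definition GB_obj ::
  "('ox, 'mx, 'oy, 'my) morita_data \<Rightarrow> 'oy \<Rightarrow> ('ox, 'mx, 'oy, 'my) em_obj" where
  "GB_obj M y = ((fobj (funT M) y, lact (mT M) y), (fobj (funB M) y, mult (mB M) y),
     ract (mT M) y, ev' M y)"

definition G_A ::
  "('ox, 'mx) cat \<Rightarrow> ('ox, 'mx, 'oy, 'my) morita_data \<Rightarrow>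
   ('ox, 'mx, ('ox, 'mx, 'oy, 'my) em_obj, ('ox, 'mx, 'oy, 'my) em_arr) func" where
  "G_A X M = \<lparr>fobj = GA_obj M,
     farr = (\<lambda>f. (GA_obj M (Dom X f), (farr (funA M) f, farr (funT' M) f), GA_obj M (Cod X f)))\<rparr>"

definition G_B ::
  "('oy, 'my) cat \<Rightarrow> ('ox, 'mx, 'oy, 'my) morita_data \<Rightarrow>
   ('oy, 'my, ('ox, 'mx, 'oy, 'my) em_obj, ('ox, 'mx, 'oy, 'my) em_arr) func" where
  "G_B Y M = \<lparr>fobj = GB_obj M,
     farr = (\<lambda>g. (GB_obj M (Dom Y g), (farr (funT M) g, farr (funB M) g), GB_obj M (Cod Y g)))\<rparr>"

end

theory Submission
  imports Defs
begin

text \<open>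
  The adjunction between \<open>G_A\<close> and \<open>U_A\<close> extends the free-algebra adjunction of the monad \<open>A\<close>.
  Its unit is the unit of \<open>A\<close>.  Its counit at an object \<open>((x, r), (y, s), v, w)\<close> is the
  pair \<open>(r, w)\<close>, an arrow from \<open>G_A x = ((A x, m), (T' x, \<lambda>'), ev, \<rho>')\<close>.

  Nothing beyond the axioms has to be computed.  The conditions for \<open>G_A x\<close> to be an object are
  monad axioms, bialgebra axioms of \<open>T'\<close> and Morita axioms (lemma \<open>GA_obj_em_object\<close>).  The
  four conditions for \<open>(r, w)\<close> to be an arrow are the associativity of \<open>r\<close> and three of the
  six compatibilities in the definition of an object (\<open>counit_hom\<close>); naturality of the counit
  consists of two of the conditions on an arrow of the Eilenberg-Moore category.  The triangle
  identities are the unit laws of the algebra \<open>(x, r)\<close>, of the monad \<open>A\<close> and of the right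
  action on \<open>T'\<close> (\<open>adjunction_G_A_U_A\<close>).

  The other adjunction comes from symmetry.  Exchanging \<open>A\<close> with \<open>B\<close> and \<open>T\<close> with \<open>T'\<close> turns a
  Morita context on \<open>X, Y\<close> into one on \<open>Y, X\<close>, and the two Eilenberg-Moore categories are
  isomorphic by exchanging components.  This isomorphism takes \<open>G_A\<close> and \<open>U_A\<close> of the exchanged
  context to \<open>G_B\<close> and \<open>U_B\<close>, and adjunctions can be transported along isomorphisms of categories
  (\<open>adjunction_transport\<close>).
\<close>

section \<open>Adjunctions and isomorphisms of categories\<close>

lemma homD:
  assumes "f \<in> hom C a b"
  shows "f \<in> Arr C" "Dom C f = a" "Cod C f = b"
  using assms by (auto simp: hom_def)

lemma (in category) hom_Obj:
  assumes "f \<in> hom C a b"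
  shows "a \<in> Obj C" "b \<in> Obj C"
  using assms Dom_Obj Cod_Obj by (auto simp: hom_def)

lemma fobj_id_func [simp]: "fobj id_func a = a"
  and farr_id_func [simp]: "farr id_func f = f"
  by (simp_all add: id_func_def)

lemma fobj_comp_func [simp]: "fobj (comp_func G F) a = fobj G (fobj F a)"
  and farr_comp_func [simp]: "farr (comp_func G F) f = farr G (farr F f)"
  by (simp_all add: comp_func_def)

lemma is_functor_id: "category C \<Longrightarrow> is_functor C C id_func"
  by (simp add: is_functor_def is_functor_axioms_def)

lemma is_functor_comp:
  assumes "is_functor C D F" "is_functor D E G"
  shows "is_functor C E (comp_func G F)"
proof -
  interpret F: is_functor C D F by fact
  interpret G: is_functor D E G by fact
  show ?thesis
  proof
    fix f g a b c
    assume f: "f \<in> hom C a b" and g: "g \<in> hom C b c"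
    show "farr (comp_func G F) (g \<cdot>\<^bsub>C\<^esub> f) = farr (comp_func G F) g \<cdot>\<^bsub>E\<^esub> farr (comp_func G F) f"
      using G.farr_Comp[OF F.farr_hom[OF f] F.farr_hom[OF g]] by (simp add: F.farr_Comp[OF f g])
  qed (auto simp: F.fobj_Obj G.fobj_Obj F.farr_Id G.farr_Id intro: F.farr_hom G.farr_hom)
qed

text \<open>
  The transported adjunction has left adjoint \<open>S L\<close> and right adjoint \<open>R S'\<close>.  Its unit is the old
  one, as \<open>R S' S L\<close> agrees with \<open>R L\<close> on the category, and its counit is \<open>S \<epsilon> S'\<close>.
\<close>

lemma adjunction_transport:
  assumes adj: "adjunction C D L R \<eta> \<epsilon>"
    and S: "is_functor D E S" and S': "is_functor E D S'"
    and S'S_obj: "\<And>d. d \<in> Obj D \<Longrightarrow> fobj S' (fobj S d) = d"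
    and S'S_arr: "\<And>h. h \<in> Arr D \<Longrightarrow> farr S' (farr S h) = h"
    and SS'_obj: "\<And>e. e \<in> Obj E \<Longrightarrow> fobj S (fobj S' e) = e"
    and SS'_arr: "\<And>h. h \<in> Arr E \<Longrightarrow> farr S (farr S' h) = h"
  shows "adjunction C E (comp_func S L) (comp_func R S') \<eta> (\<lambda>e. farr S (\<epsilon> (fobj S' e)))"
proof -
  interpret adjunction C D L R \<eta> \<epsilon> by fact
  interpret S: is_functor D E S by fact
  interpret S': is_functor E D S' by fact
  interpret SL: is_functor C E "comp_func S L"
    by (rule is_functor_comp) unfold_locales
  interpret RS': is_functor E C "comp_func R S'"
    by (rule is_functor_comp) unfold_locales
  interpret RSL: is_functor C C "comp_func (comp_func R S') (comp_func S L)"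
    by (rule is_functor_comp) unfold_locales
  interpret SLR: is_functor E E "comp_func (comp_func S L) (comp_func R S')"
    by (rule is_functor_comp) unfold_locales
  interpret idE: is_functor E E id_func
    by (rule is_functor_id) unfold_locales
  have \<epsilon>: "\<epsilon> d \<in> hom D (fobj L (fobj R d)) d" if "d \<in> Obj D" for d
    using counit.component_hom[OF that] by simp
  have \<eta>: "\<eta> a \<in> hom C a (fobj R (fobj L a))" if "a \<in> Obj C" for a
    using unit.component_hom[OF that] by simp
  show ?thesis
  proof
    fix a assume a: "a \<in> Obj C"
    show "\<eta> a \<in> hom C (fobj id_func a) (fobj (comp_func (comp_func R S') (comp_func S L)) a)"
      using \<eta>[OF a] by (simp add: S'S_obj L.fobj_Obj a)
    have "farr S (\<epsilon> (fobj L a)) \<cdot>\<^bsub>E\<^esub> farr S (farr L (\<eta> a))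
        = farr S (\<epsilon> (fobj L a) \<cdot>\<^bsub>D\<^esub> farr L (\<eta> a))"
      by (rule S.farr_Comp[symmetric, OF L.farr_hom[OF \<eta>[OF a]] \<epsilon>[OF L.fobj_Obj[OF a]]])
    then show "farr S (\<epsilon> (fobj S' (fobj (comp_func S L) a))) \<cdot>\<^bsub>E\<^esub> farr (comp_func S L) (\<eta> a)
        = Ide E (fobj (comp_func S L) a)"
      by (simp add: S'S_obj L.fobj_Obj a triangle_L S.farr_Id)
  next
    fix f a b assume f: "f \<in> hom C a b"
    then show "\<eta> b \<cdot>\<^bsub>C\<^esub> farr id_func f
        = farr (comp_func (comp_func R S') (comp_func S L)) f \<cdot>\<^bsub>C\<^esub> \<eta> a"
      using unit.naturality[OF f] homD(1)[OF L.farr_hom[OF f]] by (simp add: S'S_arr)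
  next
    fix e assume e: "e \<in> Obj E"
    show "farr S (\<epsilon> (fobj S' e)) \<in>
        hom E (fobj (comp_func (comp_func S L) (comp_func R S')) e) (fobj id_func e)"
      using S.farr_hom[OF \<epsilon>[OF S'.fobj_Obj[OF e]]] by (simp add: SS'_obj e)
    show "farr (comp_func R S') (farr S (\<epsilon> (fobj S' e))) \<cdot>\<^bsub>C\<^esub> \<eta> (fobj (comp_func R S') e)
        = Ide C (fobj (comp_func R S') e)"
      using S'.fobj_Obj[OF e] homD(1)[OF \<epsilon>] by (simp add: S'S_arr triangle_R)
  next
    fix h d e assume h: "h \<in> hom E d e"
    let ?h = "farr S' h"
    have d: "fobj S' d \<in> Obj D" and e: "fobj S' e \<in> Obj D"
      and h': "?h \<in> hom D (fobj S' d) (fobj S' e)"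
      using S.D.hom_Obj[OF h] S'.fobj_Obj S'.farr_hom[OF h] by auto
    have "farr S (\<epsilon> (fobj S' e)) \<cdot>\<^bsub>E\<^esub> farr S (farr L (farr R ?h))
        = farr S (\<epsilon> (fobj S' e) \<cdot>\<^bsub>D\<^esub> farr L (farr R ?h))"
      by (rule S.farr_Comp[symmetric, OF L.farr_hom[OF R.farr_hom[OF h']] \<epsilon>[OF e]])
    also have "\<epsilon> (fobj S' e) \<cdot>\<^bsub>D\<^esub> farr L (farr R ?h) = ?h \<cdot>\<^bsub>D\<^esub> \<epsilon> (fobj S' d)"
      using counit.naturality[OF h'] by simp
    also have "farr S (?h \<cdot>\<^bsub>D\<^esub> \<epsilon> (fobj S' d)) = h \<cdot>\<^bsub>E\<^esub> farr S (\<epsilon> (fobj S' d))"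
      using S.farr_Comp[OF \<epsilon>[OF d] h'] homD(1)[OF h] by (simp add: SS'_arr)
    finally show "farr S (\<epsilon> (fobj S' e)) \<cdot>\<^bsub>E\<^esub> farr (comp_func (comp_func S L) (comp_func R S')) h
        = farr id_func h \<cdot>\<^bsub>E\<^esub> farr S (\<epsilon> (fobj S' d))"
      by simp
  qed
qed

section \<open>The Eilenberg-Moore category\<close>

text \<open>
  The four conditions on an arrow \<open>(f, g)\<close> have the same shape: a square \<open>g w = w' (F f)\<close> for a
  functor \<open>F\<close>, one of \<open>A\<close>, \<open>B\<close>, \<open>T\<close>, \<open>T'\<close>.  Such squares are closed under composition and
  contain the identities, which is why the Eilenberg-Moore category is a category.
\<close>

lemma (in is_functor) square_Comp:
  assumes f: "f \<in> hom C a b" "f' \<in> hom C b c"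
    and g: "g \<in> hom D p q" "g' \<in> hom D q r"
    and w: "w \<in> hom D (fobj F a) p" "w' \<in> hom D (fobj F b) q" "w'' \<in> hom D (fobj F c) r"
    and sq: "g \<cdot>\<^bsub>D\<^esub> w = w' \<cdot>\<^bsub>D\<^esub> farr F f" "g' \<cdot>\<^bsub>D\<^esub> w' = w'' \<cdot>\<^bsub>D\<^esub> farr F f'"
  shows "(g' \<cdot>\<^bsub>D\<^esub> g) \<cdot>\<^bsub>D\<^esub> w = w'' \<cdot>\<^bsub>D\<^esub> farr F (f' \<cdot>\<^bsub>C\<^esub> f)"
proof -
  have "(g' \<cdot>\<^bsub>D\<^esub> g) \<cdot>\<^bsub>D\<^esub> w = g' \<cdot>\<^bsub>D\<^esub> (w' \<cdot>\<^bsub>D\<^esub> farr F f)"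
    using D.Comp_assoc[OF w(1) g] sq(1) by simp
  also have "\<dots> = (w'' \<cdot>\<^bsub>D\<^esub> farr F f') \<cdot>\<^bsub>D\<^esub> farr F f"
    using D.Comp_assoc[OF farr_hom[OF f(1)] w(2) g(2)] sq(2) by simp
  also have "\<dots> = w'' \<cdot>\<^bsub>D\<^esub> farr F (f' \<cdot>\<^bsub>C\<^esub> f)"
    using D.Comp_assoc[OF farr_hom[OF f(1)] farr_hom[OF f(2)] w(3)] farr_Comp[OF f] by simp
  finally show ?thesis .
qed

lemma (in is_functor) square_Id:
  assumes "a \<in> Obj C" "w \<in> hom D (fobj F a) p"
  shows "Ide D p \<cdot>\<^bsub>D\<^esub> w = w \<cdot>\<^bsub>D\<^esub> farr F (Ide C a)"
  using assms by (simp add: farr_Id D.Comp_Id_left D.Comp_Id_right)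

lemma EM_cat_simps [simp]:
  "P \<in> Obj (EM_cat X Y M) \<longleftrightarrow> em_object X Y M P"
  "(P, h, Q) \<in> Arr (EM_cat X Y M) \<longleftrightarrow>
     em_object X Y M P \<and> em_object X Y M Q \<and> em_morphism X Y M P Q h"
  "Dom (EM_cat X Y M) (P, h, Q) = P"
  "Cod (EM_cat X Y M) (P, h, Q) = Q"
  "Ide (EM_cat X Y M) ((x, r), (y, s), v, w) =
     (((x, r), (y, s), v, w), (Ide X x, Ide Y y), ((x, r), (y, s), v, w))"
  "(Q, (f', g'), R) \<cdot>\<^bsub>EM_cat X Y M\<^esub> (P, (f, g), Q') = (P, (f' \<cdot>\<^bsub>X\<^esub> f, g' \<cdot>\<^bsub>Y\<^esub> g), R)"
  by (simp_all add: EM_cat_def)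

lemma EM_hom [simp]:
  "(P, h, Q) \<in> hom (EM_cat X Y M) P' Q' \<longleftrightarrow>
     P = P' \<and> Q = Q' \<and> em_object X Y M P \<and> em_object X Y M Q \<and> em_morphism X Y M P Q h"
  by (auto simp: hom_def)

lemma EM_homE:
  assumes "h \<in> hom (EM_cat X Y M) P Q"
  obtains f g where "h = (P, (f, g), Q)" "em_object X Y M P" "em_object X Y M Q"
    "em_morphism X Y M P Q (f, g)"
  using assms by (cases h) auto

lemma U_A_simps [simp]:
  "fobj U_A ((x, r), (y, s), v, w) = x"
  "farr U_A (P, (f, g), Q) = f"
  by (simp_all add: U_A_def)

text \<open>
  The pair \<open>(r, w)\<close> is forced.  An arrow \<open>(f, g)\<close> out of \<open>G_A x\<close> with \<open>f u = 1\<close>, for \<open>u\<close> the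
  unit of \<open>A\<close> at \<open>x\<close>, has \<open>f = f m (A u) = r (A f) (A u) = r\<close>, and then
  \<open>g = g \<rho>' (T' u) = w (T' f) (T' u) = w\<close>.
\<close>

definition counit_A ::
  "('ox, 'mx, 'oy, 'my) morita_data \<Rightarrow>
   ('ox, 'mx, 'oy, 'my) em_obj \<Rightarrow> ('ox, 'mx, 'oy, 'my) em_arr" where
  "counit_A M = (\<lambda>((x, r), (y, s), v, w). (GA_obj M x, (r, w), ((x, r), (y, s), v, w)))"

context morita_context
begin

lemma em_morphism_Comp:
  assumes P: "em_object X Y M P" and Q: "em_object X Y M Q" and R: "em_object X Y M R"
    and PQ: "em_morphism X Y M P Q (f, g)" and QR: "em_morphism X Y M Q R (f', g')"
  shows "em_morphism X Y M P R (f' \<cdot>\<^bsub>X\<^esub> f, g' \<cdot>\<^bsub>Y\<^esub> g)"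
proof -
  obtain x r y s v w x' r' y' s' v' w' x'' r'' y'' s'' v'' w''
    where eqs: "P = ((x, r), (y, s), v, w)" "Q = ((x', r'), (y', s'), v', w')"
      "R = ((x'', r''), (y'', s''), v'', w'')"
    by (metis surj_pair)
  note defs = eqs em_object_def em_morphism_def algebra_def algebra_morphism_def
  show ?thesis
    using assms
    by (simp add: defs, elim conjE)
      (intro conjI; rule A.mfun.C.Comp_hom B.mfun.C.Comp_hom A.mfun.square_Comp
        B.mfun.square_Comp T.bfun.square_Comp T'.bfun.square_Comp; assumption)
qed

lemma em_morphism_Id:
  assumes "em_object X Y M ((x, r), (y, s), v, w)"
  shows "em_morphism X Y M ((x, r), (y, s), v, w) ((x, r), (y, s), v, w) (Ide X x, Ide Y y)"
  using assms A.mfun.C.Id_hom B.mfun.C.Id_hom A.mfun.square_Id B.mfun.square_Id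
    T.bfun.square_Id T'.bfun.square_Id
  by (simp add: em_object_def em_morphism_def algebra_def algebra_morphism_def)

sublocale EM: category "EM_cat X Y M"
proof
  fix h assume h: "h \<in> Arr (EM_cat X Y M)"
  then show "Dom (EM_cat X Y M) h \<in> Obj (EM_cat X Y M)"
    "Cod (EM_cat X Y M) h \<in> Obj (EM_cat X Y M)"
    by (cases h; simp)+
next
  fix P assume "P \<in> Obj (EM_cat X Y M)"
  then show "Ide (EM_cat X Y M) P \<in> hom (EM_cat X Y M) P P"
    by (cases P) (auto simp: em_morphism_Id)
next
  fix h k P Q R assume "h \<in> hom (EM_cat X Y M) P Q" "k \<in> hom (EM_cat X Y M) Q R"
  then show "k \<cdot>\<^bsub>EM_cat X Y M\<^esub> h \<in> hom (EM_cat X Y M) P R"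
    by (auto elim!: EM_homE intro: em_morphism_Comp)
next
  fix h P Q assume h: "h \<in> hom (EM_cat X Y M) P Q"
  show "Ide (EM_cat X Y M) Q \<cdot>\<^bsub>EM_cat X Y M\<^esub> h = h"
    using h by (cases P; cases Q)
      (auto elim!: EM_homE simp: em_morphism_def algebra_morphism_def
        A.mfun.C.Comp_Id_left B.mfun.C.Comp_Id_left)
  show "h \<cdot>\<^bsub>EM_cat X Y M\<^esub> Ide (EM_cat X Y M) P = h"
    using h by (cases P; cases Q)
      (auto elim!: EM_homE simp: em_morphism_def algebra_morphism_def
        A.mfun.C.Comp_Id_right B.mfun.C.Comp_Id_right)
next
  fix h k l P Q R S
  assume "h \<in> hom (EM_cat X Y M) P Q" "k \<in> hom (EM_cat X Y M) Q R" "l \<in> hom (EM_cat X Y M) R S"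
  then show "(l \<cdot>\<^bsub>EM_cat X Y M\<^esub> k) \<cdot>\<^bsub>EM_cat X Y M\<^esub> h
      = l \<cdot>\<^bsub>EM_cat X Y M\<^esub> (k \<cdot>\<^bsub>EM_cat X Y M\<^esub> h)"
    by (cases P; cases Q; cases R; cases S)
      (auto elim!: EM_homE simp: em_morphism_def algebra_morphism_def
        intro: A.mfun.C.Comp_assoc B.mfun.C.Comp_assoc)
qed

section \<open>The adjunction on the side of A\<close>

text \<open>
  The two algebras are the free \<open>A\<close>-algebra on \<open>x\<close> and \<open>T' x\<close> with the left \<open>B\<close>-action of \<open>T'\<close>;
  each of the six compatibilities is one axiom about \<open>T'\<close>, \<open>ev\<close> or \<open>ev'\<close>.
\<close>

lemma GA_obj_em_object:
  assumes x: "x \<in> Obj X"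
  shows "em_object X Y M (GA_obj M x)"
proof -
  have homs: "mult (mA M) x \<in> hom X (fobj (funA M) (fobj (funA M) x)) (fobj (funA M) x)"
    "lact (mT' M) x \<in> hom Y (fobj (funB M) (fobj (funT' M) x)) (fobj (funT' M) x)"
    "ev M x \<in> hom X (fobj (funT M) (fobj (funT' M) x)) (fobj (funA M) x)"
    "ract (mT' M) x \<in> hom Y (fobj (funT' M) (fobj (funA M) x)) (fobj (funT' M) x)"
    using A.mult.component_hom[OF x] T'.lact.component_hom[OF x] ev.component_hom[OF x]
      T'.ract.component_hom[OF x] by simp_all
  show ?thesis
    using homs
    by (simp add: em_object_def GA_obj_def algebra_def x A.mfun.fobj_Obj T'.bfun.fobj_Obj
        A.mult_assoc A.mult_unit_left T'.lact_mult T'.lact_unit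
        ev_lact T'.lact_ract ev_ract lact_ev' T'.ract_mult ev_balanced)
qed

lemma GA_arr_em_morphism:
  assumes f: "f \<in> hom X a b"
  shows "em_morphism X Y M (GA_obj M a) (GA_obj M b) (farr (funA M) f, farr (funT' M) f)"
  using A.mfun.farr_hom[OF f] T'.bfun.farr_hom[OF f]
    A.mult.naturality[OF f] T'.lact.naturality[OF f] ev.naturality[OF f] T'.ract.naturality[OF f]
  by (simp add: em_morphism_def GA_obj_def algebra_morphism_def)

lemma is_functor_G_A: "is_functor X (EM_cat X Y M) (G_A X M)"
proof
  fix f a b assume f: "f \<in> hom X a b"
  then show "farr (G_A X M) f \<in> hom (EM_cat X Y M) (fobj (G_A X M) a) (fobj (G_A X M) b)"
    using GA_arr_em_morphism[OF f] A.mfun.C.hom_Obj[OF f]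
    by (simp add: G_A_def homD[OF f] GA_obj_em_object)
  fix g c assume g: "g \<in> hom X b c"
  show "farr (G_A X M) (g \<cdot>\<^bsub>X\<^esub> f) = farr (G_A X M) g \<cdot>\<^bsub>EM_cat X Y M\<^esub> farr (G_A X M) f"
    by (simp add: G_A_def homD[OF f] homD[OF g] homD[OF A.mfun.C.Comp_hom[OF f g]]
        A.mfun.farr_Comp[OF f g] T'.bfun.farr_Comp[OF f g])
next
  fix a assume a: "a \<in> Obj X"
  show "farr (G_A X M) (Ide X a) = Ide (EM_cat X Y M) (fobj (G_A X M) a)"
    using homD[OF A.mfun.C.Id_hom[OF a]]
    by (simp add: G_A_def GA_obj_def A.mfun.farr_Id T'.bfun.farr_Id a)
qed (simp add: G_A_def GA_obj_em_object)

lemma is_functor_U_A: "is_functor (EM_cat X Y M) X U_A"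
proof
  fix P assume "P \<in> Obj (EM_cat X Y M)"
  then show "fobj U_A P \<in> Obj X"
    "farr U_A (Ide (EM_cat X Y M) P) = Ide X (fobj U_A P)"
    by (cases P; auto simp: em_object_def algebra_def)+
next
  fix h P Q assume h: "h \<in> hom (EM_cat X Y M) P Q"
  then show "farr U_A h \<in> hom X (fobj U_A P) (fobj U_A Q)"
    by (cases P; cases Q) (auto elim!: EM_homE simp: em_morphism_def algebra_morphism_def)
  fix k R assume "k \<in> hom (EM_cat X Y M) Q R"
  with h show "farr U_A (k \<cdot>\<^bsub>EM_cat X Y M\<^esub> h) = farr U_A k \<cdot>\<^bsub>X\<^esub> farr U_A h"
    by (auto elim!: EM_homE)
qed

lemma counit_hom:
  assumes "em_object X Y M P"
  shows "counit_A M P \<in> hom (EM_cat X Y M) (GA_obj M (fobj U_A P)) P"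
proof -
  obtain x r y s v w where P: "P = ((x, r), (y, s), v, w)" by (metis surj_pair)
  then have "x \<in> Obj X" using assms by (simp add: em_object_def algebra_def)
  then show ?thesis
    using assms GA_obj_em_object[of x]
    by (simp add: P counit_A_def)
      (simp add: em_morphism_def em_object_def GA_obj_def algebra_def algebra_morphism_def)
qed

lemma adjunction_G_A_U_A:
  "adjunction X (EM_cat X Y M) (G_A X M) U_A (unit (mA M)) (counit_A M)"
proof -
  interpret G: is_functor X "EM_cat X Y M" "G_A X M" by (rule is_functor_G_A)
  interpret U: is_functor "EM_cat X Y M" X U_A by (rule is_functor_U_A)
  interpret UG: is_functor X X "comp_func U_A (G_A X M)"
    by (rule is_functor_comp) unfold_locales
  interpret GU: is_functor "EM_cat X Y M" "EM_cat X Y M" "comp_func (G_A X M) U_A"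
    by (rule is_functor_comp) unfold_locales
  interpret id: is_functor "EM_cat X Y M" "EM_cat X Y M" id_func
    by (rule is_functor_id) unfold_locales
  show ?thesis
  proof
    fix x assume x: "x \<in> Obj X"
    show u: "unit (mA M) x \<in> hom X (fobj id_func x) (fobj (comp_func U_A (G_A X M)) x)"
      using A.unit.component_hom[OF x] by (simp add: G_A_def GA_obj_def)
    show "counit_A M (fobj (G_A X M) x) \<cdot>\<^bsub>EM_cat X Y M\<^esub> farr (G_A X M) (unit (mA M) x)
        = Ide (EM_cat X Y M) (fobj (G_A X M) x)"
      using homD(2)[OF u]
      by (simp add: G_A_def counit_A_def GA_obj_def A.mult_unit_right T'.ract_unit x)
  next
    fix f a b assume f: "f \<in> hom X a b"
    show "unit (mA M) b \<cdot>\<^bsub>X\<^esub> farr id_func f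
        = farr (comp_func U_A (G_A X M)) f \<cdot>\<^bsub>X\<^esub> unit (mA M) a"
      using A.unit.naturality[OF f] by (simp add: G_A_def)
  next
    fix P assume P: "P \<in> Obj (EM_cat X Y M)"
    show "counit_A M P \<in>
        hom (EM_cat X Y M) (fobj (comp_func (G_A X M) U_A) P) (fobj id_func P)"
      using counit_hom[of P] P by (simp add: G_A_def)
    show "farr U_A (counit_A M P) \<cdot>\<^bsub>X\<^esub> unit (mA M) (fobj U_A P) = Ide X (fobj U_A P)"
      using P by (cases P) (auto simp: counit_A_def em_object_def algebra_def)
  next
    fix h P Q assume "h \<in> hom (EM_cat X Y M) P Q"
    then show "counit_A M Q \<cdot>\<^bsub>EM_cat X Y M\<^esub> farr (comp_func (G_A X M) U_A) h
        = farr id_func h \<cdot>\<^bsub>EM_cat X Y M\<^esub> counit_A M P"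
      by (cases P; cases Q)
        (auto elim!: EM_homE simp: G_A_def counit_A_def em_morphism_def algebra_morphism_def
          homD(2,3))
  qed
qed

end

section \<open>Exchanging the two sides\<close>

definition swap_morita ::
  "('ox, 'mx, 'oy, 'my) morita_data \<Rightarrow> ('oy, 'my, 'ox, 'mx) morita_data" where
  "swap_morita M =
     \<lparr>mA = mB M, mB = mA M, mT = mT' M, mT' = mT M, ev = ev' M, ev' = ev M\<rparr>"

lemma swap_morita_simps [simp]:
  "mA (swap_morita M) = mB M" "mB (swap_morita M) = mA M"
  "mT (swap_morita M) = mT' M" "mT' (swap_morita M) = mT M"
  "ev (swap_morita M) = ev' M" "ev' (swap_morita M) = ev M"
  by (simp_all add: swap_morita_def)

lemma swap_morita_swap_morita [simp]: "swap_morita (swap_morita M) = M"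
  by (simp add: swap_morita_def)

definition swap_EM ::
  "(('ox, 'mx, 'oy, 'my) em_obj, ('ox, 'mx, 'oy, 'my) em_arr,
    ('oy, 'my, 'ox, 'mx) em_obj, ('oy, 'my, 'ox, 'mx) em_arr) func" where
  "swap_EM =
     (let S = (\<lambda>(a, b, v, w). (b, a, w, v))
      in \<lparr>fobj = S, farr = (\<lambda>(P, (f, g), Q). (S P, (g, f), S Q))\<rparr>)"

lemma swap_EM_simps [simp]:
  "fobj swap_EM (a, b, v, w) = (b, a, w, v)"
  "farr swap_EM (P, (f, g), Q) = (fobj swap_EM P, (g, f), fobj swap_EM Q)"
  by (simp_all add: swap_EM_def Let_def)

lemma swap_EM_swap_EM [simp]:
  "fobj swap_EM (fobj swap_EM P) = P" "farr swap_EM (farr swap_EM h) = h"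
proof -
  show *: "fobj swap_EM (fobj swap_EM P) = P" for P :: "('a, 'b, 'c, 'd) em_obj"
    by (cases P) simp
  show "farr swap_EM (farr swap_EM h) = h"
    by (cases h) (auto simp: *)
qed

text \<open>
  The exchange permutes the Morita axioms: \<open>ev_lact\<close> and \<open>ev_ract\<close> change places with their
  primed counterparts, while \<open>ract_ev'\<close> with \<open>lact_ev'\<close>, and \<open>ev'_balanced\<close> with
  \<open>ev_balanced\<close>, change places after interchanging the sides of each equation.
\<close>

lemma morita_context_swap:
  assumes "morita_context X Y M"
  shows "morita_context Y X (swap_morita M)"
proof -
  interpret morita_context X Y M by fact
  show ?thesis
    by (intro morita_context.intro morita_context_axioms.intro)
      (simp_all add: A.monad_axioms B.monad_axioms T.bialgebra_functor_axioms
        T'.bialgebra_functor_axioms ev.nat_trans_axioms ev'.nat_trans_axioms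
        ev_lact ev_ract ev'_lact ev'_ract ract_ev' lact_ev' ev'_balanced ev_balanced)
qed

lemma em_object_swap:
  "em_object Y X (swap_morita M) (fobj swap_EM P) \<longleftrightarrow> em_object X Y M P"
  by (cases P) (auto simp: em_object_def)

lemma em_morphism_swap:
  "em_morphism Y X (swap_morita M) (fobj swap_EM P) (fobj swap_EM Q) (g, f) \<longleftrightarrow>
     em_morphism X Y M P Q (f, g)"
  by (cases P; cases Q) (auto simp: em_morphism_def)

lemma is_functor_swap_EM:
  assumes "morita_context X Y M"
  shows "is_functor (EM_cat X Y M) (EM_cat Y X (swap_morita M)) swap_EM"
proof -
  interpret M: morita_context X Y M by fact
  interpret M': morita_context Y X "swap_morita M" by (rule morita_context_swap) fact
  show ?thesis
  proof
    fix P assume P: "P \<in> Obj (EM_cat X Y M)"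
    then show "fobj swap_EM P \<in> Obj (EM_cat Y X (swap_morita M))"
      by (simp add: em_object_swap)
    show "farr swap_EM (Ide (EM_cat X Y M) P) = Ide (EM_cat Y X (swap_morita M)) (fobj swap_EM P)"
      by (cases P) auto
  next
    fix h P Q assume h: "h \<in> hom (EM_cat X Y M) P Q"
    then show "farr swap_EM h \<in>
        hom (EM_cat Y X (swap_morita M)) (fobj swap_EM P) (fobj swap_EM Q)"
      by (auto elim!: EM_homE simp: em_object_swap em_morphism_swap)
    fix k R assume "k \<in> hom (EM_cat X Y M) Q R"
    with h show "farr swap_EM (k \<cdot>\<^bsub>EM_cat X Y M\<^esub> h)
        = farr swap_EM k \<cdot>\<^bsub>EM_cat Y X (swap_morita M)\<^esub> farr swap_EM h"
      by (auto elim!: EM_homE)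
  qed
qed

lemma G_B_eq_swap: "G_B Y M = comp_func swap_EM (G_A Y (swap_morita M))"
  by (auto simp: G_B_def G_A_def comp_func_def GB_obj_def GA_obj_def fun_eq_iff)

lemma U_B_eq_swap: "U_B = comp_func U_A swap_EM"
  by (auto simp: U_B_def comp_func_def fun_eq_iff)

theorem lemma3p3p1:
  fixes X :: "('ox, 'mx) cat" and Y :: "('oy, 'my) cat"
    and M :: "('ox, 'mx, 'oy, 'my) morita_data"
  assumes "morita_context X Y M"
  shows "double_adjunction X Y (EM_cat X Y M) (G_A X M, U_A) (G_B Y M, U_B)"
proof -
  interpret M: morita_context X Y M by fact
  interpret M': morita_context Y X "swap_morita M" by (rule morita_context_swap) fact
  have "is_functor (EM_cat Y X (swap_morita M)) (EM_cat X Y M) swap_EM"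
    using is_functor_swap_EM[OF M'.morita_context_axioms] by simp
  then have "adjunction Y (EM_cat X Y M) (G_B Y M) U_B (unit (mB M))
      (\<lambda>P. farr swap_EM (counit_A (swap_morita M) (fobj swap_EM P)))"
    unfolding G_B_eq_swap U_B_eq_swap
    using adjunction_transport[OF M'.adjunction_G_A_U_A _ is_functor_swap_EM[OF assms]]
    by simp
  moreover have "category X" "category Y" "category (EM_cat X Y M)"
    by unfold_locales
  ultimately show ?thesis
    using M.adjunction_G_A_U_A by (auto simp: double_adjunction_def adjoint_pair_def)
qed

end
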